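(* There exists a robust Markov decision process $(\mathcal S,\mathcal A,\mathcal P,r,\gamma)$ (with an initial state distribution $\rho\in\Delta_{\mathcal S}$) such that the set of robust visitation distributions $$\left\{ d^{\pi}_{\rho,\mathsf P^\pi}\in\Delta_{\mathcal S\times\mathcal A} \;:\; \pi\in\Pi\right\},$$ where $\mathsf P^\pi$ is the worst-case transition kernel of $\pi$, is non-convex.
   Context: $\Delta_X$ denotes the probability simplex on a finite set $X$. A robust MDP is a tuple $(\mathcal S,\mathcal A,\mathcal P,r,\gamma)$ with finite state space $\mathcal S$ and action space $\mathcal A$, reward function $r$ on $\mathcal S\times\mathcal A$, discount factor $\gamma\in[0,1)$ and $(s,a)$-rectangular uncertainty set of transition kernels $\mathcal P=\bigotimes_{s,a}\mathcal P_s^a$, $\mathcal P_s^a\subseteq\Delta_{\mathcal S}$; a kernel is $\mathsf P=\{p_s^a\in\Delta_{\mathcal S}\}$. $\Pi$ is the set of all stationary policies $\pi:\mathcal S\to\Delta_{\mathcal A}$. The robust value function of $\pi$ is $V_r^\pi(s)=\min_{\kappa\in\bigotimes_{t\ge0}\mathcal P}\mathbb E_\kappa\left[\sum_{t=0}^\infty\gamma^t r(S_t,A_t)\mid S_0=s,\pi\right]$, where $\kappa=(\mathsf P_0,\mathsf P_1,\dots)$ with $\mathsf P_t\in\mathcal P$ the kernel used at time $t$. The minimizer $\kappa^*$ is stationary in time, $\kappa^*=(\mathsf P^\pi,\mathsf P^\pi,\dots)$, and $\mathsf P^\pi$ is called the worst-case transition kernel of $\pi$; each policy is assigned this one kernel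 $\mathsf P^\pi$. For a policy $\pi$ and a kernel $\mathsf P$, the visitation distribution is $d^\pi_{\rho,\mathsf P}(s,a)=(1-\gamma)\sum_{t=0}^\infty\gamma^t\,\mathbb P(S_t=s,A_t=a\mid S_0\sim\rho,\pi,\mathsf P)$. The robust visitation distribution of $\pi$ is the visitation distribution $d^\pi_{\rho,\mathsf P^\pi}$ induced by $\pi$ and $\mathsf P^\pi$. *)

theory Defs
  imports "HOL-Probability.Probability" "HOL-Library.Function_Algebras"
begin

text \<open>
  Pointwise scalar multiplication makes functions a real vector space, so that the library
  notion \<^const>\<open>convex\<close> applies to sets of functions on state-action pairs.
\<close>

instantiation "fun" :: (type, real_vector) real_vector
begin

definition scaleR_fun :: "real \<Rightarrow> ('a \<Rightarrow> 'b) \<Rightarrow> 'a \<Rightarrow> 'b" where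
  "scaleR_fun c f = (\<lambda>x. c *\<^sub>R f x)"

instance
  by standard (auto simp: scaleR_fun_def fun_eq_iff scaleR_add_right scaleR_add_left)

end

definition simplex_on :: "'x set \<Rightarrow> 'x pmf set" where
  "simplex_on X = {p. set_pmf p \<subseteq> X}"

record ('s, 'a) rmdp =
  states :: "'s set"
  actions :: "'a set"
  uncertainty :: "'s \<times> 'a \<Rightarrow> 's pmf set"
  reward :: "'s \<times> 'a \<Rightarrow> real"
  discount :: real

definition robust_mdp :: "('s, 'a) rmdp \<Rightarrow> bool" where
  "robust_mdp M \<longleftrightarrow>
     finite (states M) \<and> states M \<noteq> {} \<and> finite (actions M) \<and> actions M \<noteq> {} \<and>
     (\<forall>x \<in> states M \<times> actions M.
        uncertainty M x \<noteq> {} \<and> uncertainty M x \<subseteq> simplex_on (states M)) \<and>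
     0 \<le> discount M \<and> discount M < 1"

text \<open>
  Policies and kernels are extensional functions, so each of them has exactly one representative.
\<close>

definition policies :: "('s, 'a) rmdp \<Rightarrow> ('s \<Rightarrow> 'a pmf) set" where
  "policies M = (states M \<rightarrow>\<^sub>E simplex_on (actions M))"

definition kernels :: "('s, 'a) rmdp \<Rightarrow> ('s \<times> 'a \<Rightarrow> 's pmf) set" where
  "kernels M = PiE (states M \<times> actions M) (uncertainty M)"

text \<open>
  Conditional law of \<open>(S\<^sub>t, A\<^sub>t)\<close> given the history \<open>\<omega>\<close> of earlier state-action pairs:
  \<open>S\<^sub>0\<close> is drawn from \<open>\<rho>\<close>, \<open>S\<^sub>t\<^sub>+\<^sub>1\<close> from the time-\<open>t\<close> kernel, and \<open>A\<^sub>t\<close> from \<open>\<pi> S\<^sub>t\<close>.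
\<close>

definition step ::
  "'s pmf \<Rightarrow> ('s \<Rightarrow> 'a pmf) \<Rightarrow> (nat \<Rightarrow> 's \<times> 'a \<Rightarrow> 's pmf) \<Rightarrow> nat \<Rightarrow> (nat \<Rightarrow> 's \<times> 'a) \<Rightarrow> ('s \<times> 'a) pmf"
  where
  "step \<rho> \<pi> \<kappa> t \<omega> =
     bind_pmf (case t of 0 \<Rightarrow> \<rho> | Suc u \<Rightarrow> \<kappa> u (\<omega> u)) (\<lambda>s. map_pmf (Pair s) (\<pi> s))"

lemma Ionescu_Tulcea_step:
  "Ionescu_Tulcea (\<lambda>t \<omega>. measure_pmf (step \<rho> \<pi> \<kappa> t \<omega>)) (\<lambda>_. count_space UNIV)"
proof (unfold_locales)
  fix t :: nat
  show "(\<lambda>\<omega>. measure_pmf (step \<rho> \<pi> \<kappa> t \<omega>))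
      \<in> measurable (PiM {0..<t} (\<lambda>_. count_space UNIV)) (subprob_algebra (count_space UNIV))"
  proof (cases t)
    case 0
    then show ?thesis
      by (simp add: step_def space_subprob_algebra measure_pmf.subprob_space_axioms)
  next
    case (Suc u)
    define g where "g x = measure_pmf (bind_pmf (\<kappa> u x) (\<lambda>s. map_pmf (Pair s) (\<pi> s)))" for x
    have "g \<in> measurable (count_space UNIV) (subprob_algebra (count_space UNIV))"
      by (simp add: g_def space_subprob_algebra measure_pmf.subprob_space_axioms)
    moreover have "(\<lambda>\<omega>. \<omega> u) \<in> measurable (PiM {0..<t} (\<lambda>_. count_space UNIV)) (count_space UNIV)"
      using Suc by (intro measurable_component_singleton) auto
    ultimately show ?thesis
      using measurable_compose[of "\<lambda>\<omega>. \<omega> u" _ _ g] by (simp add: step_def Suc g_def)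
  qed
qed

text \<open>
  The law of the whole trajectory \<open>(S\<^sub>t, A\<^sub>t)\<^sub>t\<close>: the measure on sequences which the Ionescu-Tulcea
  theorem provides for the conditional laws \<^const>\<open>step\<close>.
\<close>

definition trajectory ::
  "'s pmf \<Rightarrow> ('s \<Rightarrow> 'a pmf) \<Rightarrow> (nat \<Rightarrow> 's \<times> 'a \<Rightarrow> 's pmf) \<Rightarrow> (nat \<Rightarrow> 's \<times> 'a) measure" where
  "trajectory \<rho> \<pi> \<kappa> =
     projective_family.lim UNIV
       (Ionescu_Tulcea.CI (\<lambda>t \<omega>. measure_pmf (step \<rho> \<pi> \<kappa> t \<omega>)) (\<lambda>_. count_space UNIV))
       (\<lambda>_. count_space UNIV)"

definition expected_return ::
  "('s, 'a) rmdp \<Rightarrow> ('s \<Rightarrow> 'a pmf) \<Rightarrow> 's \<Rightarrow> (nat \<Rightarrow> 's \<times> 'a \<Rightarrow> 's pmf) \<Rightarrow> real" where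
  "expected_return M \<pi> s \<kappa> =
     (\<integral>\<omega>. (\<Sum>t. discount M ^ t * reward M (\<omega> t)) \<partial>trajectory (return_pmf s) \<pi> \<kappa>)"

text \<open>
  A worst-case kernel attains, when used at every time step, the minimum defining the robust value
  function, simultaneously for all initial states. The minimum ranges over all sequences of kernels
  in the uncertainty set, not only over the time-stationary ones.
\<close>

definition worst_case_kernel ::
  "('s, 'a) rmdp \<Rightarrow> ('s \<Rightarrow> 'a pmf) \<Rightarrow> ('s \<times> 'a \<Rightarrow> 's pmf) \<Rightarrow> bool" where
  "worst_case_kernel M \<pi> P \<longleftrightarrow>
     (\<forall>s \<in> states M. is_arg_min (expected_return M \<pi> s) (\<lambda>\<kappa>. \<forall>t. \<kappa> t \<in> kernels M) (\<lambda>_. P))"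

definition visitation ::
  "('s, 'a) rmdp \<Rightarrow> 's pmf \<Rightarrow> ('s \<Rightarrow> 'a pmf) \<Rightarrow> ('s \<times> 'a \<Rightarrow> 's pmf) \<Rightarrow> 's \<times> 'a \<Rightarrow> real" where
  "visitation M \<rho> \<pi> P = (\<lambda>(s, a).
     (1 - discount M) *
     (\<Sum>t. discount M ^ t * \<P>(\<omega> in trajectory \<rho> \<pi> (\<lambda>_. P). \<omega> t = (s, a))))"

text \<open>
  Worst-case kernels need not be unique; \<open>w\<close> assigns one of them to each policy.
\<close>

definition worst_case_assignment ::
  "('s, 'a) rmdp \<Rightarrow> (('s \<Rightarrow> 'a pmf) \<Rightarrow> 's \<times> 'a \<Rightarrow> 's pmf) \<Rightarrow> bool" where
  "worst_case_assignment M w \<longleftrightarrow> (\<forall>\<pi> \<in> policies M. worst_case_kernel M \<pi> (w \<pi>))"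

definition robust_visitations ::
  "('s, 'a) rmdp \<Rightarrow> 's pmf \<Rightarrow> (('s \<Rightarrow> 'a pmf) \<Rightarrow> 's \<times> 'a \<Rightarrow> 's pmf) \<Rightarrow> ('s \<times> 'a \<Rightarrow> real) set" where
  "robust_visitations M \<rho> w = {visitation M \<rho> \<pi> (w \<pi>) | \<pi>. \<pi> \<in> policies M}"

end

theory Submission
  imports Defs
begin

text \<open>
  From state \<open>0\<close> nature moves, with any distribution it likes, to one of the absorbing states \<open>1\<close>
  and \<open>2\<close>. State \<open>2\<close> pays nothing, and state \<open>1\<close> pays \<open>-1\<close> for action \<open>0\<close> and \<open>1\<close> for action \<open>1\<close>.
  So nature moves to \<open>1\<close> if the policy prefers action \<open>0\<close> there, and to \<open>2\<close> if it prefers action \<open>1\<close>.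
  The midpoint of the visitations of two policies of these two kinds charges both absorbing
  states, but never action \<open>1\<close> in state \<open>1\<close>. A policy realising it would thus choose action \<open>0\<close> in
  state \<open>1\<close>, nature would avoid state \<open>2\<close>, and \<open>2\<close> would not be charged.
\<close>

section \<open>Marginal laws of the trajectory\<close>

definition joint_law :: "'s pmf \<Rightarrow> ('s \<Rightarrow> 'a pmf) \<Rightarrow> ('s \<times> 'a) pmf" where
  "joint_law \<sigma> \<pi> = bind_pmf \<sigma> (\<lambda>s. map_pmf (Pair s) (\<pi> s))"

text \<open>The forward Kolmogorov recursion for the law of the state at time \<open>t\<close>. It
  stays on the level of pmfs, so the example can be computed without the path measure.\<close>

primrec state_law ::
  "'s pmf \<Rightarrow> ('s \<Rightarrow> 'a pmf) \<Rightarrow> (nat \<Rightarrow> 's \<times> 'a \<Rightarrow> 's pmf) \<Rightarrow> nat \<Rightarrow> 's pmf" where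
  "state_law \<rho> \<pi> \<kappa> 0 = \<rho>"
| "state_law \<rho> \<pi> \<kappa> (Suc t) = bind_pmf (joint_law (state_law \<rho> \<pi> \<kappa> t) \<pi>) (\<kappa> t)"

lemma pmf_joint_law: "pmf (joint_law \<sigma> \<pi>) (s, a) = pmf \<sigma> s * pmf (\<pi> s) a"
proof -
  have "pmf (map_pmf (Pair s') (\<pi> s')) (s, a) = indicator {s} s' * pmf (\<pi> s) a" for s'
  proof (cases "s' = s")
    case True
    then show ?thesis by (simp add: pmf_map_inj' inj_def)
  next
    case False
    then show ?thesis by (auto simp: pmf_eq_0_set_pmf)
  qed
  then show ?thesis
    by (simp add: joint_law_def pmf_bind measure_pmf_single)
qed

lemma bind_joint_law:
  "bind_pmf (joint_law \<sigma> \<pi>) f = bind_pmf \<sigma> (\<lambda>s. bind_pmf (\<pi> s) (\<lambda>a. f (s, a)))"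
  by (simp add: joint_law_def bind_assoc_pmf bind_map_pmf)

lemma step_eq_joint_law:
  "step \<rho> \<pi> \<kappa> t \<omega> = joint_law (case t of 0 \<Rightarrow> \<rho> | Suc u \<Rightarrow> \<kappa> u (\<omega> u)) \<pi>"
  by (simp add: step_def joint_law_def)

text \<open>The step law depends on the history only through its last pair, so integrating out one
  time step after another reproduces the recursion of \<open>state_law\<close>. The projective limit
  agrees with the finite-horizon measures on cylinders.\<close>

lemma emeasure_trajectory_component:
  "emeasure (trajectory \<rho> \<pi> \<kappa>) {\<omega>. \<omega> t \<in> A} =
    emeasure (measure_pmf (joint_law (state_law \<rho> \<pi> \<kappa> t) \<pi>)) A"
proof -
  let ?M = "\<lambda>_::nat. count_space (UNIV :: ('a \<times> 'b) set)"
  interpret IT: Ionescu_Tulcea "\<lambda>t \<omega>. measure_pmf (step \<rho> \<pi> \<kappa> t \<omega>)" ?M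
    by (rule Ionescu_Tulcea_step)
  have eP: "(\<integral>\<^sup>+\<omega>'. f (\<omega>' t) \<partial>IT.eP t \<omega>) = (\<integral>\<^sup>+x. f x \<partial>measure_pmf (step \<rho> \<pi> \<kappa> t \<omega>))"
    if "\<omega> \<in> space (PiM {0..<t} ?M)" for t \<omega> f
    using IT.nn_integral_eP[OF that, of "\<lambda>\<omega>'. f (\<omega>' t)"]
      measurable_compose[OF measurable_component_singleton[of t "{0..<Suc t}" ?M], of f]
    by simp
  \<comment> \<open>\<open>IT.C 0 (Suc t)\<close> is the law of the pairs at times 0 to
    \<open>t\<close>. It starts from the empty history, whose only extensional representative is
    \<open>\<lambda>_. undefined\<close>.\<close>
  have C: "(\<integral>\<^sup>+\<omega>. f (\<omega> t) \<partial>IT.C 0 (Suc t) (\<lambda>_. undefined)) =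
      (\<integral>\<^sup>+x. f x \<partial>measure_pmf (joint_law (state_law \<rho> \<pi> \<kappa> t) \<pi>))" for t f
  proof (induction t arbitrary: f)
    case (0 f)
    have "IT.C 0 (Suc 0) (\<lambda>_. undefined) = IT.eP 0 (\<lambda>_. undefined)"
      using bind_return[OF IT.measurable_eP[of 0], of "\<lambda>_. undefined"] by (simp add: space_PiM)
    then show ?case
      using eP[of "\<lambda>_. undefined" 0 f] by (simp add: space_PiM) (simp add: step_eq_joint_law)
  next
    case (Suc t f)
    have [measurable]: "(\<lambda>\<omega>. f (\<omega> (Suc t))) \<in> borel_measurable (PiM {0..<Suc (Suc t)} ?M)"
      by (rule measurable_compose[OF measurable_component_singleton]) auto
    have "(\<integral>\<^sup>+\<omega>. f (\<omega> (Suc t)) \<partial>IT.C 0 (Suc (Suc t)) (\<lambda>_. undefined)) =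
        (\<integral>\<^sup>+\<omega>. \<integral>\<^sup>+\<omega>'. f (\<omega>' (Suc t)) \<partial>IT.eP (Suc t) \<omega> \<partial>IT.C 0 (Suc t) (\<lambda>_. undefined))"
      unfolding IT.C.simps(2)[of 0 "Suc t"] add_0
    proof (rule nn_integral_bind)
      show "IT.eP (Suc t) \<in> measurable (IT.C 0 (Suc t) (\<lambda>_. undefined))
          (subprob_algebra (PiM {0..<Suc (Suc t)} ?M))"
        using IT.measurable_eP[of "Suc t"] IT.sets_C[of "\<lambda>_. undefined" 0 "Suc t"]
        by (simp add: space_PiM cong: measurable_cong_sets del: IT.C.simps)
    qed measurable
    also have "\<dots> = (\<integral>\<^sup>+\<omega>. \<integral>\<^sup>+x. f x \<partial>measure_pmf (joint_law (\<kappa> t (\<omega> t)) \<pi>) \<partial>IT.C 0 (Suc t) (\<lambda>_. undefined))"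
      by (intro nn_integral_cong)
        (simp del: IT.C.simps add: eP IT.space_C space_PiM, simp add: step_eq_joint_law)
    \<comment> \<open>The inner integral is a function of \<open>\<omega> t\<close> alone; the
      induction hypothesis is applied to this function, hence the arbitrary
      \<open>f\<close>.\<close>
    also have "\<dots> = (\<integral>\<^sup>+x. f x \<partial>measure_pmf (joint_law (state_law \<rho> \<pi> \<kappa> (Suc t)) \<pi>))"
      by (subst Suc.IH) (simp add: joint_law_def bind_assoc_pmf)
    finally show ?case .
  qed
  \<comment> \<open>The event is a cylinder over the single coordinate \<open>t\<close>, and the
    horizon \<open>Suc t\<close> is the first to contain that coordinate.\<close>
  let ?X = "PiE {t} (\<lambda>_. A)"
  have X: "?X \<in> sets (PiM {t} ?M)"
    by (rule sets_PiM_I_finite) auto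
  have "emeasure (trajectory \<rho> \<pi> \<kappa>) {\<omega>. \<omega> t \<in> A} =
      emeasure IT.PF.lim (IT.PF.emb UNIV {t} ?X)"
    unfolding trajectory_def
    by (intro arg_cong2[where f = emeasure] refl) (auto simp: prod_emb_def PiE_iff)
  also have "\<dots> = emeasure (IT.C 0 (Suc t) (\<lambda>_. undefined)) (IT.PF.emb {0..<Suc t} {t} ?X)"
    using IT.lim[OF _ X] IT.emeasure_CI[OF _ X, of "Suc t"] by simp
  also have "\<dots> = (\<integral>\<^sup>+\<omega>. indicator (IT.PF.emb {0..<Suc t} {t} ?X) \<omega> \<partial>IT.C 0 (Suc t) (\<lambda>_. undefined))"
    using X by (intro nn_integral_indicator[symmetric])
      (auto simp del: IT.C.simps simp: IT.sets_C space_PiM)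
  also have "\<dots> = (\<integral>\<^sup>+\<omega>. indicator A (\<omega> t) \<partial>IT.C 0 (Suc t) (\<lambda>_. undefined))"
    by (intro nn_integral_cong)
      (auto simp del: IT.C.simps simp: IT.space_C space_PiM prod_emb_def PiE_iff split: split_indicator)
  also have "\<dots> = emeasure (measure_pmf (joint_law (state_law \<rho> \<pi> \<kappa> t) \<pi>)) A"
    by (subst C) simp
  finally show ?thesis .
qed

section \<open>The path measure and the laws of its coordinates\<close>

lemma sets_trajectory: "sets (trajectory \<rho> \<pi> \<kappa>) = sets (PiM UNIV (\<lambda>_. count_space UNIV))"
proof -
  interpret IT: Ionescu_Tulcea "\<lambda>t \<omega>. measure_pmf (step \<rho> \<pi> \<kappa> t \<omega>)" "\<lambda>_. count_space UNIV"
    by (rule Ionescu_Tulcea_step)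
  show ?thesis by (simp add: trajectory_def)
qed

lemma space_trajectory: "space (trajectory \<rho> \<pi> \<kappa>) = UNIV"
  using sets_eq_imp_space_eq[OF sets_trajectory] by (simp add: space_PiM)

lemma prob_space_trajectory: "prob_space (trajectory \<rho> \<pi> \<kappa>)"
  using emeasure_trajectory_component[of \<rho> \<pi> \<kappa> 0 UNIV]
  by (intro prob_spaceI) (simp add: space_trajectory)

lemma measurable_trajectory_component:
  "(\<lambda>\<omega>. \<omega> t) \<in> measurable (trajectory \<rho> \<pi> \<kappa>) (count_space UNIV)"
  by (subst measurable_cong_sets[OF sets_trajectory refl]) simp

lemma distr_trajectory_component:
  "distr (trajectory \<rho> \<pi> \<kappa>) (count_space UNIV) (\<lambda>\<omega>. \<omega> t) =
    measure_pmf (joint_law (state_law \<rho> \<pi> \<kappa> t) \<pi>)"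
proof (rule measure_eqI)
  fix A
  show "emeasure (distr (trajectory \<rho> \<pi> \<kappa>) (count_space UNIV) (\<lambda>\<omega>. \<omega> t)) A =
      emeasure (measure_pmf (joint_law (state_law \<rho> \<pi> \<kappa> t) \<pi>)) A"
    by (simp add: emeasure_distr measurable_trajectory_component space_trajectory
        vimage_def emeasure_trajectory_component)
qed simp

section \<open>Visitations and returns as series over marginal laws\<close>

lemma visitation_eq:
  "visitation M \<rho> \<pi> P (s, a) =
    (1 - discount M) * (\<Sum>t. discount M ^ t * (pmf (state_law \<rho> \<pi> (\<lambda>_. P) t) s * pmf (\<pi> s) a))"
  using emeasure_trajectory_component[of \<rho> \<pi> "\<lambda>_. P" _ "{(s, a)}"]
  by (simp add: visitation_def measure_def space_trajectory emeasure_pmf_single pmf_joint_law)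

text \<open>A bounded reward makes the series dominated by a geometric one, so sum and integral can
  be exchanged. Each term then involves a single coordinate of the trajectory.\<close>

lemma expected_return_eq:
  assumes "0 \<le> discount M" "discount M < 1" and bounded: "\<And>x. \<bar>reward M x\<bar> \<le> B"
  shows "expected_return M \<pi> s \<kappa> =
    (\<Sum>t. discount M ^ t *
      measure_pmf.expectation (joint_law (state_law (return_pmf s) \<pi> \<kappa> t) \<pi>) (reward M))"
proof -
  let ?T = "trajectory (return_pmf s) \<pi> \<kappa>"
  interpret T: prob_space ?T by (rule prob_space_trajectory)
  have meas: "(\<lambda>\<omega>. reward M (\<omega> t)) \<in> borel_measurable ?T" for t
    by (rule measurable_compose[OF measurable_trajectory_component]) simp
  have int: "integrable ?T (\<lambda>\<omega>. reward M (\<omega> t))" for t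
    by (rule T.integrable_const_bound[where B = B]) (use bounded meas in auto)
  have le: "\<bar>discount M ^ t * reward M x\<bar> \<le> discount M ^ t * B" for t x
    using assms by (simp add: abs_mult mult_left_mono)
  have summable_B: "summable (\<lambda>t. discount M ^ t * B)"
    using assms by (intro summable_mult2 summable_geometric) auto
  have "expected_return M \<pi> s \<kappa> = (\<Sum>t. \<integral>\<omega>. discount M ^ t * reward M (\<omega> t) \<partial>?T)"
    unfolding expected_return_def
  proof (rule integral_suminf)
    show "AE \<omega> in ?T. summable (\<lambda>t. norm (discount M ^ t * reward M (\<omega> t)))"
      using le by (intro AE_I2 summable_comparison_test'[OF summable_B]) simp
    have "(\<integral>\<omega>. norm (discount M ^ t * reward M (\<omega> t)) \<partial>?T) \<le> discount M ^ t * B" for t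
      using integral_mono[of ?T "\<lambda>\<omega>. norm (discount M ^ t * reward M (\<omega> t))" "\<lambda>_. discount M ^ t * B"]
        int[of t] le by (simp add: T.prob_space)
    then show "summable (\<lambda>t. \<integral>\<omega>. norm (discount M ^ t * reward M (\<omega> t)) \<partial>?T)"
      by (intro summable_comparison_test'[OF summable_B]) (simp add: integral_nonneg_AE)
  qed (use int in simp)
  also have "\<dots> = (\<Sum>t. discount M ^ t *
      measure_pmf.expectation (joint_law (state_law (return_pmf s) \<pi> \<kappa> t) \<pi>) (reward M))"
    by (simp add: distr_trajectory_component[symmetric] integral_distr measurable_trajectory_component)
  finally show ?thesis .
qed

section \<open>The counterexample\<close>

definition example_mdp :: "(nat, nat) rmdp" where
  "example_mdp =
    \<lparr>states = {0, 1, 2}, actions = {0, 1},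
     uncertainty = (\<lambda>(s, a). if s = 0 then simplex_on {1, 2} else {return_pmf s}),
     reward = (\<lambda>x. if x = (1, 1) then 1 else if x = (1, 0) then -1 else 0),
     discount = 1 / 2\<rparr>"

lemma robust_mdp_example: "robust_mdp example_mdp"
  by (auto simp: robust_mdp_def example_mdp_def simplex_on_def intro: exI[of _ "return_pmf 1"])

text \<open>The expected one-step reward in state 1; its sign decides where nature moves.\<close>

definition gain :: "(nat \<Rightarrow> nat pmf) \<Rightarrow> real" where
  "gain \<pi> = pmf (\<pi> 1) 1 - pmf (\<pi> 1) 0"

text \<open>The law of the state at time 1 after a start in state 0.\<close>

definition successor :: "(nat \<Rightarrow> nat pmf) \<Rightarrow> (nat \<times> nat \<Rightarrow> nat pmf) \<Rightarrow> nat pmf" where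
  "successor \<pi> P = bind_pmf (\<pi> 0) (\<lambda>a. P (0, a))"

lemma expectation_reward_example:
  "measure_pmf.expectation (joint_law \<sigma> \<pi>) (reward example_mdp) = pmf \<sigma> 1 * gain \<pi>"
  by (subst integral_measure_pmf_real[where A = "{(1, 0), (1, 1)}"])
    (auto simp: example_mdp_def gain_def pmf_joint_law algebra_simps split: if_splits)

lemma set_policy:
  "\<lbrakk>\<pi> \<in> policies example_mdp; s \<in> {0, 1, 2}\<rbrakk> \<Longrightarrow> set_pmf (\<pi> s) \<subseteq> {0, 1}"
  by (auto simp: policies_def example_mdp_def simplex_on_def PiE_iff)

lemma set_successor:
  assumes "\<pi> \<in> policies example_mdp" "P \<in> kernels example_mdp"
  shows "set_pmf (successor \<pi> P) \<subseteq> {1, 2}"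
  using assms(2) set_policy[OF assms(1), of 0]
  by (fastforce simp: successor_def kernels_def example_mdp_def simplex_on_def PiE_iff)

text \<open>In states 1 and 2 the uncertainty sets are singletons containing the point mass at the
  current state, so every admissible kernel fixes a law supported there.\<close>

lemma state_law_absorbed:
  assumes "\<pi> \<in> policies example_mdp" "P \<in> kernels example_mdp" "set_pmf \<sigma> \<subseteq> {1, 2}"
  shows "bind_pmf (joint_law \<sigma> \<pi>) P = \<sigma>"
proof -
  have "bind_pmf (\<pi> s) (\<lambda>a. P (s, a)) = return_pmf s" if "s \<in> set_pmf \<sigma>" for s
  proof -
    have "s \<in> {1, 2}" using that assms(3) by auto
    then have "P (s, a) = return_pmf s" if "a \<in> set_pmf (\<pi> s)" for a
      using that assms(2) set_policy[OF assms(1), of s]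
      by (auto simp: kernels_def example_mdp_def PiE_iff)
    then show ?thesis by (simp cong: bind_pmf_cong)
  qed
  then show ?thesis
    by (simp add: bind_joint_law bind_return_pmf' cong: bind_pmf_cong)
qed

text \<open>The first move already reaches an absorbing state, so the law is frozen from time 1 on.
  This reduces arbitrary kernel sequences to their kernel at time 0.\<close>

lemma state_law_start:
  assumes "\<pi> \<in> policies example_mdp" "\<And>t. \<kappa> t \<in> kernels example_mdp"
  shows "state_law (return_pmf 0) \<pi> \<kappa> (Suc t) = successor \<pi> (\<kappa> 0)"
proof (induction t)
  case 0
  show ?case by (simp add: successor_def bind_joint_law bind_return_pmf)
next
  case (Suc t)
  then show ?case
    using state_law_absorbed[OF assms(1) assms(2) set_successor[OF assms(1) assms(2)]] by simp
qed

lemma state_law_absorbing: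
  assumes "\<pi> \<in> policies example_mdp" "\<And>t. \<kappa> t \<in> kernels example_mdp" "s \<in> {1, 2}"
  shows "state_law (return_pmf s) \<pi> \<kappa> t = return_pmf s"
  using assms by (induction t) (auto simp: state_law_absorbed)

section \<open>Closed forms of returns and visitations\<close>

lemma suminf_half_shifted:
  fixes f :: "nat \<Rightarrow> real"
  assumes "\<And>t. f (Suc t) = c"
  shows "(\<Sum>t. (1 / 2) ^ t * f t) = f 0 + c"
proof -
  \<comment> \<open>\<open>c / 2\<close> absorbs one factor of the shifted weight. With discount 1/2
    the weights from time 1 on sum to 1, so \<open>c\<close> appears without a constant.\<close>
  have "(\<lambda>t. (1 / 2) ^ t * (c / 2)) sums (1 / (1 - 1 / 2) * (c / 2))"
    by (intro sums_mult2 geometric_sums) simp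
  then have "(\<lambda>t. (1 / 2) ^ Suc t * f (Suc t)) sums c"
    by (simp add: assms algebra_simps)
  from sums_Suc[OF this] show ?thesis
    by (simp add: sums_unique[symmetric] add.commute)
qed

lemma expected_return_example:
  "expected_return example_mdp \<pi> s \<kappa> =
    (\<Sum>t. (1 / 2) ^ t * (pmf (state_law (return_pmf s) \<pi> \<kappa> t) 1 * gain \<pi>))"
  by (subst expected_return_eq[where B = 1])
    (simp_all add: expectation_reward_example, simp_all add: example_mdp_def)

lemma expected_return_start:
  assumes "\<pi> \<in> policies example_mdp" "\<And>t. \<kappa> t \<in> kernels example_mdp"
  shows "expected_return example_mdp \<pi> 0 \<kappa> = pmf (successor \<pi> (\<kappa> 0)) 1 * gain \<pi>"
  unfolding expected_return_example
  by (subst suminf_half_shifted[where c = "pmf (successor \<pi> (\<kappa> 0)) 1 * gain \<pi>"])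
    (simp_all only: state_law_start[OF assms], simp)

text \<open>The assumption \<open>s \<noteq> 0\<close> makes the term at time 0 vanish, and the
  division by 2 is the normalisation by one minus the discount.\<close>

lemma visitation_example:
  assumes "\<pi> \<in> policies example_mdp" "P \<in> kernels example_mdp" "s \<noteq> 0"
  shows "visitation example_mdp (return_pmf 0) \<pi> P (s, a) =
    pmf (successor \<pi> P) s * pmf (\<pi> s) a / 2"
proof -
  have "(\<Sum>t. (1 / 2) ^ t * (pmf (state_law (return_pmf 0) \<pi> (\<lambda>_. P) t) s * pmf (\<pi> s) a)) =
      pmf (successor \<pi> P) s * pmf (\<pi> s) a"
    by (subst suminf_half_shifted[where c = "pmf (successor \<pi> P) s * pmf (\<pi> s) a"])
      (simp_all only: state_law_start[OF assms(1), of "\<lambda>_. P", OF assms(2)], use assms(3) in simp)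
  then show ?thesis
    unfolding visitation_eq by (simp add: example_mdp_def)
qed

section \<open>Worst-case kernels of the example\<close>

definition kernel_to :: "nat \<Rightarrow> nat \<times> nat \<Rightarrow> nat pmf" where
  "kernel_to i = (\<lambda>(s, a) \<in> {0, 1, 2} \<times> {0, 1}. return_pmf (if s = 0 then i else s))"

lemma kernel_to_in_kernels: "i \<in> {1, 2} \<Longrightarrow> kernel_to i \<in> kernels example_mdp"
  by (auto simp: kernel_to_def kernels_def example_mdp_def simplex_on_def)

lemma successor_kernel_to:
  assumes "\<pi> \<in> policies example_mdp"
  shows "successor \<pi> (kernel_to i) = return_pmf i"
proof -
  have "successor \<pi> (kernel_to i) = bind_pmf (\<pi> 0) (\<lambda>_. return_pmf i)"
    unfolding successor_def using set_policy[OF assms, of 0]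
    by (intro bind_pmf_cong) (auto simp: kernel_to_def)
  then show ?thesis by simp
qed

text \<open>From states 1 and 2 every kernel sequence gives the same return, so only the start in
  state 0 is a constraint. There the return is linear in the probability of moving to state
  1.\<close>

lemma worst_case_kernel_example_iff:
  assumes "\<pi> \<in> policies example_mdp"
  shows "worst_case_kernel example_mdp \<pi> P \<longleftrightarrow>
    P \<in> kernels example_mdp \<and>
    (\<forall>Q \<in> kernels example_mdp.
      pmf (successor \<pi> P) 1 * gain \<pi> \<le> pmf (successor \<pi> Q) 1 * gain \<pi>)"
    (is "_ \<longleftrightarrow> ?P \<and> ?min")
proof
  assume "worst_case_kernel example_mdp \<pi> P"
  then have "is_arg_min (expected_return example_mdp \<pi> 0) (\<lambda>\<kappa>. \<forall>t. \<kappa> t \<in> kernels example_mdp) (\<lambda>_. P)"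
    by (auto simp: worst_case_kernel_def example_mdp_def)
  then have P: ?P and min: "\<And>\<kappa>. (\<And>t. \<kappa> t \<in> kernels example_mdp) \<Longrightarrow>
      expected_return example_mdp \<pi> 0 (\<lambda>_. P) \<le> expected_return example_mdp \<pi> 0 \<kappa>"
    by (auto simp: is_arg_min_def not_less)
  have ?min
  proof
    fix Q assume "Q \<in> kernels example_mdp"
    then show "pmf (successor \<pi> P) 1 * gain \<pi> \<le> pmf (successor \<pi> Q) 1 * gain \<pi>"
      \<comment> \<open>A competing kernel is tested through the constant sequence that repeats
        it.\<close>
      using min[of "\<lambda>_. Q"] P assms by (simp add: expected_return_start)
  qed
  with P show "?P \<and> ?min" ..
next
  assume *: "?P \<and> ?min"
  show "worst_case_kernel example_mdp \<pi> P"
    unfolding worst_case_kernel_def is_arg_min_def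
  proof (intro ballI conjI notI)
    show "\<forall>t. P \<in> kernels example_mdp" using * by simp
    fix s assume "s \<in> states example_mdp"
    then consider "s = 0" | "s \<in> {1, 2}" by (auto simp: example_mdp_def)
    note cases = this
    assume "\<exists>\<kappa>. (\<forall>t. \<kappa> t \<in> kernels example_mdp) \<and>
      expected_return example_mdp \<pi> s \<kappa> < expected_return example_mdp \<pi> s (\<lambda>_. P)"
    then obtain \<kappa> where \<kappa>: "\<And>t. \<kappa> t \<in> kernels example_mdp"
      and less: "expected_return example_mdp \<pi> s \<kappa> < expected_return example_mdp \<pi> s (\<lambda>_. P)"
      by auto
    from cases show False
    proof cases
      case 1
      then show False
        using less * \<kappa>[of 0] expected_return_start[OF assms \<kappa>] expected_return_start[OF assms, of "\<lambda>_. P"]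
        by (force simp: not_less)
    next
      case 2
      then show False
        using less * \<kappa> by (simp add: expected_return_example state_law_absorbing[OF assms] del: insert_iff)
    qed
  qed
qed

text \<open>A linear function on [0, 1] is minimal at an endpoint, and the two deterministic kernels
  realise both endpoints. The tie at gain 0 is broken in favour of state 1.\<close>

lemma worst_case_kernel_to:
  assumes "\<pi> \<in> policies example_mdp"
  shows "worst_case_kernel example_mdp \<pi> (kernel_to (if gain \<pi> \<le> 0 then 1 else 2))"
  unfolding worst_case_kernel_example_iff[OF assms] successor_kernel_to[OF assms]
proof (intro conjI ballI)
  show "kernel_to (if gain \<pi> \<le> 0 then 1 else 2) \<in> kernels example_mdp"
    by (simp add: kernel_to_in_kernels)
  fix Q
  show "pmf (return_pmf (if gain \<pi> \<le> 0 then 1 else 2 :: nat)) 1 * gain \<pi> \<le> pmf (successor \<pi> Q) 1 * gain \<pi>"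
    using mult_right_mono_neg[of "pmf (successor \<pi> Q) 1" 1 "gain \<pi>"] by (simp add: pmf_le_1)
qed

text \<open>Kernels may still differ on actions that the policy never takes in state 0, but a
  nonzero gain forces the endpoint and with it the successor law. Hence the argument covers every
  worst-case assignment.\<close>

lemma worst_case_successor:
  assumes "\<pi> \<in> policies example_mdp" "worst_case_kernel example_mdp \<pi> P"
  shows "gain \<pi> < 0 \<Longrightarrow> successor \<pi> P = return_pmf 1"
    and "0 < gain \<pi> \<Longrightarrow> successor \<pi> P = return_pmf 2"
proof -
  let ?q = "successor \<pi> P"
  have P: "P \<in> kernels example_mdp"
    and "\<forall>Q \<in> kernels example_mdp. pmf ?q 1 * gain \<pi> \<le> pmf (successor \<pi> Q) 1 * gain \<pi>"
    using assms by (auto simp: worst_case_kernel_example_iff)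
  then have min: "pmf ?q 1 * gain \<pi> \<le> pmf (return_pmf i) 1 * gain \<pi>" if "i \<in> {1, 2}" for i :: nat
    using kernel_to_in_kernels[OF that] successor_kernel_to[OF assms(1), of i] by metis
  note q = set_successor[OF assms(1) P]
  show "?q = return_pmf 1" if "gain \<pi> < 0"
  proof -
    \<comment> \<open>Comparison with \<open>kernel_to 1\<close> bounds
      \<open>pmf ?q 1 * gain \<pi>\<close> by \<open>gain \<pi>\<close>; dividing by the negative
      gain reverses the inequality.\<close>
    have "pmf ?q 1 = 1"
      using min[of 1] that pmf_le_1[of ?q 1] by simp
    then show ?thesis
      using set_pmf_subset_singleton[of ?q 1] measure_pmf.prob_eq_1[of "{1}" ?q]
      by (auto simp: measure_pmf_single AE_measure_pmf_iff)
  qed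
  show "?q = return_pmf 2" if "0 < gain \<pi>"
  proof -
    have "pmf ?q 1 = 0"
      using min[of 2] that pmf_nonneg[of ?q 1] by (simp add: mult_le_0_iff)
    then have "set_pmf ?q \<subseteq> {2}" using q by (auto simp: pmf_eq_0_set_pmf)
    then show ?thesis by (simp add: set_pmf_subset_singleton)
  qed
qed

text \<open>Worst-case kernels can be ambiguous, so non-convexity is claimed for every assignment;
  the existence of one keeps this claim from being vacuous.\<close>

theorem lemma1:
  shows "\<exists>(M :: (nat, nat) rmdp) \<rho>.
    robust_mdp M \<and> \<rho> \<in> simplex_on (states M) \<and>
    (\<exists>w. worst_case_assignment M w) \<and>
    (\<forall>w. worst_case_assignment M w \<longrightarrow> \<not> convex (robust_visitations M \<rho> w))"
proof (intro exI[of _ example_mdp] exI[of _ "return_pmf 0"] conjI allI impI notI)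
  show "robust_mdp example_mdp" by (rule robust_mdp_example)
  show "return_pmf 0 \<in> simplex_on (states example_mdp)"
    by (simp add: simplex_on_def example_mdp_def)
  show "\<exists>w. worst_case_assignment example_mdp w"
    using worst_case_kernel_to
    by (intro exI[of _ "\<lambda>\<pi>. kernel_to (if gain \<pi> \<le> 0 then 1 else 2)"])
      (simp add: worst_case_assignment_def)
next
  fix w
  assume w: "worst_case_assignment example_mdp w"
    and convex: "convex (robust_visitations example_mdp (return_pmf 0) w)"
  let ?d = "\<lambda>\<pi>. visitation example_mdp (return_pmf 0) \<pi> (w \<pi>)"
  have worst: "worst_case_kernel example_mdp \<pi> (w \<pi>)" if "\<pi> \<in> policies example_mdp" for \<pi>
    using w that by (simp add: worst_case_assignment_def)
  then have d: "?d \<pi> (s, a) = pmf (successor \<pi> (w \<pi>)) s * pmf (\<pi> s) a / 2"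
    if "\<pi> \<in> policies example_mdp" "s \<noteq> 0" for \<pi> s a
    using that by (simp add: visitation_example worst_case_kernel_example_iff)
  \<comment> \<open>The two policies differ only in state 1. Nature answers
    \<open>\<pi>\<^sub>b 0\<close> by moving to state 1 and \<open>\<pi>\<^sub>b 1\<close> by moving
    to state 2, where action 0 is played.\<close>
  define \<pi>\<^sub>b where "\<pi>\<^sub>b b = (\<lambda>s \<in> {0, 1, 2::nat}. return_pmf (if s = 1 then b else 0))" for b :: nat
  have policies: "\<pi>\<^sub>b 0 \<in> policies example_mdp" "\<pi>\<^sub>b 1 \<in> policies example_mdp"
    by (auto simp: \<pi>\<^sub>b_def policies_def example_mdp_def simplex_on_def)
  have gain: "gain (\<pi>\<^sub>b 0) = -1" "gain (\<pi>\<^sub>b 1) = 1"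
    by (simp_all add: gain_def \<pi>\<^sub>b_def)
  note d0 = d[OF policies(1)] worst_case_successor(1)[OF policies(1) worst[OF policies(1)]]
  note d1 = d[OF policies(2)] worst_case_successor(2)[OF policies(2) worst[OF policies(2)]]
  have "(1 / 2) *\<^sub>R ?d (\<pi>\<^sub>b 0) + (1 / 2) *\<^sub>R ?d (\<pi>\<^sub>b 1) \<in> robust_visitations example_mdp (return_pmf 0) w"
    using policies by (intro convexD[OF convex]) (auto simp: robust_visitations_def)
  then obtain \<pi> where \<pi>: "\<pi> \<in> policies example_mdp"
    and mid: "(1 / 2) *\<^sub>R ?d (\<pi>\<^sub>b 0) + (1 / 2) *\<^sub>R ?d (\<pi>\<^sub>b 1) = ?d \<pi>"
    by (auto simp: robust_visitations_def)
  have mid: "?d \<pi> x = ?d (\<pi>\<^sub>b 0) x / 2 + ?d (\<pi>\<^sub>b 1) x / 2" for x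
    by (simp add: mid[symmetric] scaleR_fun_def)
  let ?q = "successor \<pi> (w \<pi>)"
  \<comment> \<open>Both endpoint visitations put mass 1/2 on their absorbing pair, (1, 0) or (2,
    0). The midpoint halves this to 1/4, and cancelling the normalisation 1/2 leaves 1/2.\<close>
  have "pmf ?q 1 * pmf (\<pi> 1) 0 = 1 / 2" "pmf ?q 1 * pmf (\<pi> 1) 1 = 0" "pmf ?q 2 * pmf (\<pi> 2) 0 = 1 / 2"
    using mid[of "(1, 0)"] mid[of "(1, 1)"] mid[of "(2, 0)"]
    by (simp_all add: d[OF \<pi>] d0 d1 gain del: One_nat_def)
      (simp_all add: \<pi>\<^sub>b_def mult_ac disj_commute)
  \<comment> \<open>The first product makes \<open>pmf ?q 1\<close> and
    \<open>pmf (\<pi> 1) 0\<close> nonzero, so the second forces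
    \<open>pmf (\<pi> 1) 1 = 0\<close>.\<close>
  moreover from this have "gain \<pi> < 0"
    using pmf_nonneg[of "\<pi> 1" 0] by (auto simp: gain_def order_less_le)
  \<comment> \<open>A negative gain sends all mass to state 1, whereas the third product requires
    mass in state 2.\<close>
  ultimately show False
    using worst_case_successor(1)[OF \<pi> worst[OF \<pi>]] by simp
qed

end
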